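(* Let $\boldsymbol{\alpha}=(a_0,a_1,a_2,\dots)$ be a sequence with $a_k\in\{0,1\}=\mathbb{F}_2$ for all $k\ge 0$, and let $\Psi(\boldsymbol{\alpha})=(|a_1-a_0|,|a_2-a_1|,|a_3-a_2|,\dots)$ be the next row of the Proth–Gilbreath triangle generated by $\boldsymbol{\alpha}$. Let $\phi(\boldsymbol{\alpha})=\sum_{k\ge 0}a_kX^k\in\mathbb{F}_2[[X]]$. Then $\boldsymbol{\alpha}$ is ultimately replicated identically in $\Psi(\boldsymbol{\alpha})$ if and only if there exist an integer $r\ge 0$ and a polynomial $P(X)\in\mathbb{F}_2[X]$ such that either $$\phi(\boldsymbol{\alpha})=\frac{P(X)}{1+X+X^r}\qquad\text{or}\qquad \phi(\boldsymbol{\alpha})=\frac{P(X)}{X^r(1+X)+1}.$$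
   Context: The Proth–Gilbreath (PG) operator $\Psi$ sends a sequence of non-negative integers $(a_0,a_1,\dots)$ to the sequence $(|a_1-a_0|,|a_2-a_1|,\dots)$ of absolute differences of consecutive terms; iterating it produces the rows of the Proth–Gilbreath triangle. For $0/1$ entries, $|a_{k+1}-a_k|=a_k+a_{k+1}$ computed in $\mathbb{F}_2$. A row $\boldsymbol{\beta}=(b_0,b_1,\dots)$ is "ultimately replicated identically" in a row $\boldsymbol{\gamma}=(c_0,c_1,\dots)$ if there exist integers $m,n\ge 0$ such that $b_{m+k}=c_{n+k}$ for all $k\ge 0$. An equality $\phi=P/D$ with $P,D\in\mathbb{F}_2[X]$ means $D(X)\phi=P(X)$ in $\mathbb{F}_2[[X]]$. *)

theory Defs
  imports
    "HOL-Library.Z2"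
    "HOL-Computational_Algebra.Formal_Power_Series"
    "HOL-Computational_Algebra.Polynomial_FPS"
begin

definition PG_op :: "(nat \<Rightarrow> nat) \<Rightarrow> (nat \<Rightarrow> nat)" where
  "PG_op a = (\<lambda>k. nat \<bar>int (a (Suc k)) - int (a k)\<bar>)"

definition ultimately_replicated_in :: "(nat \<Rightarrow> 'a) \<Rightarrow> (nat \<Rightarrow> 'a) \<Rightarrow> bool" where
  "ultimately_replicated_in b c \<longleftrightarrow> (\<exists>m n. \<forall>k. b (m + k) = c (n + k))"

definition gen_fps :: "(nat \<Rightarrow> nat) \<Rightarrow> bit fps" where
  "gen_fps a = Abs_fps (\<lambda>k. of_nat (a k))"

text \<open>The equation \<open>\<phi> = P / D\<close> is read as \<open>D \<phi> = P\<close>. The library division on formal power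
  series is not used, since it discards low-order terms when \<open>D\<close> has zero constant coefficient,
  as happens for \<open>D = 1 + X + X\<^sup>0 = X\<close>.\<close>
definition fps_is_quotient :: "'a::comm_ring_1 fps \<Rightarrow> 'a poly \<Rightarrow> 'a poly \<Rightarrow> bool" where
  "fps_is_quotient \<phi> P D \<longleftrightarrow> fps_of_poly D * \<phi> = fps_of_poly P"

end

theory Submission
  imports Defs
begin

text \<open>
  Over the two-element field, replication says \<open>b\<^sub>m\<^sub>+\<^sub>k = b\<^sub>n\<^sub>+\<^sub>k + b\<^sub>n\<^sub>+\<^sub>k\<^sub>+\<^sub>1\<close> for all \<open>k\<close>.
  On the other side, a power series is a polynomial iff its coefficients eventually vanish, so
  the two quotient conditions are the eventual recurrences obtained by reading off the
  coefficients of \<open>D \<phi>\<close>. They match for \<open>r = n + 1 - m\<close> (first denominator) and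
  \<open>r = m - (n + 1)\<close> (second denominator), according to the sign of \<open>n + 1 - m\<close>.
\<close>

lemma ex_fps_of_poly_iff:
  fixes f :: "'a::zero fps"
  shows "(\<exists>P. f = fps_of_poly P) \<longleftrightarrow> (\<exists>M. \<forall>N\<ge>M. fps_nth f N = 0)"
proof
  assume "\<exists>P. f = fps_of_poly P"
  then obtain P where "f = fps_of_poly P" by blast
  then have "\<forall>N\<ge>Suc (degree P). fps_nth f N = 0"
    by (simp add: coeff_eq_0)
  then show "\<exists>M. \<forall>N\<ge>M. fps_nth f N = 0" by blast
next
  assume "\<exists>M. \<forall>N\<ge>M. fps_nth f N = 0"
  \<comment> \<open>The strict bound is the form in which \<open>coeff_Abs_poly\<close> expects the
    vanishing of the coefficients.\<close>
  then obtain M where "\<And>N. N > M \<Longrightarrow> fps_nth f N = 0" by (meson less_imp_le)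
  then have "f = fps_of_poly (Abs_poly (fps_nth f))"
    by (simp add: fps_eq_iff coeff_Abs_poly[where n = M])
  then show "\<exists>P. f = fps_of_poly P" by blast
qed

lemma bit_add_eq_0_iff: "x + y = 0 \<longleftrightarrow> x = y" for x y :: bit
  by (cases x; cases y) simp_all

lemma of_nat_PG_op:
  assumes "\<And>k. a k \<in> {0, 1}"
  shows "(of_nat (PG_op a k) :: bit) = of_nat (a k) + of_nat (a (Suc k))"
  using assms[of k] assms[of "Suc k"] by (auto simp: PG_op_def)

lemma of_nat_bit_eq_iff:
  assumes "x \<in> {0, 1}" "y \<in> {0, 1}"
  shows "(of_nat x :: bit) = of_nat y \<longleftrightarrow> x = y"
  using assms by auto

text \<open>Both rows take values in {0, 1}, where \<open>of_nat\<close> into \<open>bit\<close> is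
  injective, so equality of entries can be tested in the field; there the absolute difference
  becomes a sum.\<close>

lemma ultimately_replicated_in_PG_op_iff:
  assumes "\<And>k. a k \<in> {0, 1}"
  defines "f \<equiv> gen_fps a"
  shows "ultimately_replicated_in a (PG_op a) \<longleftrightarrow>
    (\<exists>m n. \<forall>k. fps_nth f (m + k) = fps_nth f (n + k) + fps_nth f (Suc (n + k)))"
proof -
  have "PG_op a k \<in> {0, 1}" for k
    using assms(1)[of k] assms(1)[of "Suc k"] by (auto simp: PG_op_def)
  then have "a i = PG_op a j \<longleftrightarrow> fps_nth f i = fps_nth f j + fps_nth f (Suc j)" for i j
    using of_nat_bit_eq_iff[of "a i" "PG_op a j"] assms(1)
    by (simp add: f_def gen_fps_def of_nat_PG_op)
  then show ?thesis
    by (simp add: ultimately_replicated_in_def)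
qed

lemma ex_quotient_iff_recurrence1:
  fixes f :: "bit fps"
  shows "(\<exists>P. fps_is_quotient f P (1 + monom 1 1 + monom 1 r)) \<longleftrightarrow>
    (\<exists>M. \<forall>N\<ge>M. fps_nth f (Suc N) = fps_nth f (N + r) + fps_nth f (Suc (N + r)))"
    (is "?L \<longleftrightarrow> ?R")
proof -
  let ?g = "fps_of_poly (1 + monom 1 1 + monom 1 r) * f"
  have "?g = f + fps_X * f + fps_X ^ r * f"
    by (simp add: fps_of_poly_add fps_of_poly_monom' distrib_right)
  \<comment> \<open>The index \<open>Suc (N + r)\<close> is at least 1 and at least r, so neither
    shift falls below coefficient 0. Characteristic 2 lets a term change sides without a
    sign.\<close>
  then have nth: "fps_nth ?g (Suc (N + r)) = 0 \<longleftrightarrow>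
      fps_nth f (Suc N) = fps_nth f (N + r) + fps_nth f (Suc (N + r))" for N
    by (auto simp: fps_X_power_mult_nth bit_add_eq_0_iff add.commute Suc_diff_le)
  have "?L \<longleftrightarrow> (\<exists>M. \<forall>N\<ge>M. fps_nth ?g N = 0)"
    by (simp add: fps_is_quotient_def ex_fps_of_poly_iff)
  also have "\<dots> \<longleftrightarrow> (\<forall>\<^sub>F N in sequentially. fps_nth ?g N = 0)"
    by (simp add: eventually_sequentially)
  \<comment> \<open>Vanishing from some point on is insensitive to a shift of the index, so only the
    coefficients covered by \<open>nth\<close> matter.\<close>
  also have "\<dots> \<longleftrightarrow> (\<forall>\<^sub>F N in sequentially. fps_nth ?g (N + Suc r) = 0)"
    by (rule eventually_sequentially_seg [symmetric])
  also have "\<dots> \<longleftrightarrow> ?R"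
    by (simp only: eventually_sequentially add_Suc_right nth)
  finally show ?thesis .
qed

lemma ex_quotient_iff_recurrence2:
  fixes f :: "bit fps"
  shows "(\<exists>P. fps_is_quotient f P (monom 1 r * (1 + monom 1 1) + 1)) \<longleftrightarrow>
    (\<exists>M. \<forall>N\<ge>M. fps_nth f (Suc (N + r)) = fps_nth f N + fps_nth f (Suc N))"
    (is "?L \<longleftrightarrow> ?R")
proof -
  let ?g = "fps_of_poly (monom 1 r * (1 + monom 1 1) + 1) * f"
  have "?g = fps_X ^ r * (f + fps_X * f) + f"
    by (simp add: fps_of_poly_add fps_of_poly_mult fps_of_poly_monom' algebra_simps)
  \<comment> \<open>Here the factor 1 + X is delayed by r, so the isolated term is the one of
    highest index.\<close>
  then have nth: "fps_nth ?g (Suc (N + r)) = 0 \<longleftrightarrow>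
      fps_nth f (Suc (N + r)) = fps_nth f N + fps_nth f (Suc N)" for N
    by (auto simp: fps_X_power_mult_nth bit_add_eq_0_iff add.commute Suc_diff_le)
  have "?L \<longleftrightarrow> (\<exists>M. \<forall>N\<ge>M. fps_nth ?g N = 0)"
    by (simp add: fps_is_quotient_def ex_fps_of_poly_iff)
  also have "\<dots> \<longleftrightarrow> (\<forall>\<^sub>F N in sequentially. fps_nth ?g N = 0)"
    by (simp add: eventually_sequentially)
  also have "\<dots> \<longleftrightarrow> (\<forall>\<^sub>F N in sequentially. fps_nth ?g (N + Suc r) = 0)"
    by (rule eventually_sequentially_seg [symmetric])
  also have "\<dots> \<longleftrightarrow> ?R"
    by (simp only: eventually_sequentially add_Suc_right nth)
  finally show ?thesis .
qed

text \<open>Up to the choice of starting point, only the integer m - n matters. The first family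
  covers the differences 1 - r, the second 1 + r; together they exhaust the integers.\<close>

lemma ex_shifted_recurrence_iff:
  fixes R :: "nat \<Rightarrow> nat \<Rightarrow> bool"
  shows "(\<exists>m n. \<forall>k. R (m + k) (n + k)) \<longleftrightarrow>
    (\<exists>r. (\<exists>M. \<forall>N\<ge>M. R (Suc N) (N + r)) \<or> (\<exists>M. \<forall>N\<ge>M. R (Suc (N + r)) N))"
    (is "?L \<longleftrightarrow> ?R")
proof
  assume ?L
  then obtain m n where R: "\<And>k. R (m + k) (n + k)" by blast
  show ?R
  proof (cases "m \<le> Suc n")
    case True
    \<comment> \<open>Take k = Suc N - m; the case assumption makes \<open>Suc n - m\<close> an
      untruncated difference.\<close>
    have "R (Suc N) (N + (Suc n - m))" if "N \<ge> m" for N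
      using R[of "Suc N - m"] True that by (simp add: algebra_simps)
    then show ?thesis by blast
  next
    case False
    have "R (Suc (N + (m - Suc n))) N" if "N \<ge> n" for N
    proof -
      have "Suc (N + (m - Suc n)) = m + (N - n)" "n + (N - n) = N"
        using False that by simp_all
      then show ?thesis using R[of "N - n"] by metis
    qed
    then show ?thesis by blast
  qed
next
  assume ?R
  then obtain r M where
    "(\<forall>N\<ge>M. R (Suc N) (N + r)) \<or> (\<forall>N\<ge>M. R (Suc (N + r)) N)" by blast
  then show ?L
  proof
    assume *: "\<forall>N\<ge>M. R (Suc N) (N + r)"
    have "R (Suc M + k) (M + r + k)" for k
      using *[rule_format, of "M + k"] by (simp add: algebra_simps)
    then show ?L by blast
  next
    assume *: "\<forall>N\<ge>M. R (Suc (N + r)) N"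
    have "R (Suc (M + r) + k) (M + k)" for k
      using *[rule_format, of "M + k"] by (simp add: algebra_simps)
    then show ?L by blast
  qed
qed

theorem theorem2:
  fixes a :: "nat \<Rightarrow> nat"
  assumes "\<And>k. a k \<in> {0, 1}"
  shows "ultimately_replicated_in a (PG_op a) \<longleftrightarrow>
    (\<exists>(r::nat) (P :: bit poly).
       fps_is_quotient (gen_fps a) P (1 + monom 1 1 + monom 1 r) \<or>
       fps_is_quotient (gen_fps a) P (monom 1 r * (1 + monom 1 1) + 1))"
  \<comment> \<open>The type instantiation splits the disjunction under the quantifier over P only;
    r stays shared, as \<open>ex_shifted_recurrence_iff\<close> requires. There R i j is the
    relation $f_i = f_j + f_{j+1}$ between coefficients.\<close>
  unfolding ultimately_replicated_in_PG_op_iff[OF assms] ex_disj_distrib[where 'a = "bit poly"]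
    ex_quotient_iff_recurrence1 ex_quotient_iff_recurrence2
  by (rule ex_shifted_recurrence_iff)

end
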